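(* Let $F$ be Thompson's group. For each pair of integers $m,n\ge 0$, $F$ contains an infinite family of quasi-isometrically embedded subgroups of the form $F^m\times\mathbb{Z}^n$.
   Context: Thompson's group $F$ is the group with infinite presentation $\langle x_k,\ k\ge 0 \mid x_i^{-1}x_jx_i=x_{j+1}\text{ if } i<j\rangle$; it is generated by $x_0,x_1$ and has the finite presentation $\langle x_0,x_1\mid [x_0x_1^{-1},x_0^{-1}x_1x_0],\,[x_0x_1^{-1},x_0^{-2}x_1x_0^2]\rangle$. Here $F^m$ is the direct product of $m$ copies of $F$, and a subgroup of the form $F^m\times\mathbb{Z}^n$ means a subgroup of $F$ isomorphic to $F^m\times\mathbb{Z}^n$. A map $f:X\to Y$ of metric spaces is a quasi-isometric embedding if for some constants $K\ge1$, $C\ge0$ one has $\frac1K d_X(x,y)-C\le d_Y(f(x),f(y))\le K d_X(x,y)+C$ for all $x,y\in X$. A finitely generated subgroup $H$ of a finitely generated group $G$ is quasi-isometrically embedded if the inclusion $H\hookrightarrow G$ is a quasi-isometric embedding with respect to word metrics of finite generating sets on $H$ and $G$ (this does not depend on the choice of finite generating sets).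
   Formalization: For m = n = 0 the group F^0 × Z^0 is trivial and F has only one trivial subgroup, so no infinite family of distinct subgroups exists; the subgroups in the family are claimed to be pairwise distinct only when (m, n) is not (0, 0). *)

theory Defs
  imports Complex_Main "HOL-Algebra.Product_Groups"
begin

section \<open>Groups given by generators and relations\<close>

text \<open>A letter \<open>(a, True)\<close> stands for the generator \<open>a\<close>, and \<open>(a, False)\<close> for its inverse.
  The generators are all the elements of the type \<open>'a\<close>.\<close>

type_synonym 'a word = "('a \<times> bool) list"

text \<open>The congruence on words generated by free cancellation and the relations \<open>R\<close>, where a
  pair \<open>(u, v) \<in> R\<close> is the relation \<open>u = v\<close>.\<close>

inductive word_equiv :: "('a word \<times> 'a word) set \<Rightarrow> 'a word \<Rightarrow> 'a word \<Rightarrow> bool"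
  for R where
  refl: "word_equiv R u u"
| sym: "word_equiv R u v \<Longrightarrow> word_equiv R v u"
| trans: "word_equiv R u v \<Longrightarrow> word_equiv R v w \<Longrightarrow> word_equiv R u w"
| append: "word_equiv R u u' \<Longrightarrow> word_equiv R v v' \<Longrightarrow> word_equiv R (u @ v) (u' @ v')"
| cancel: "word_equiv R [(a, b), (a, \<not> b)] []"
| rel: "(u, v) \<in> R \<Longrightarrow> word_equiv R u v"

definition word_class :: "('a word \<times> 'a word) set \<Rightarrow> 'a word \<Rightarrow> 'a word set" where
  "word_class R u = {v. word_equiv R u v}"

definition presented_group :: "('a word \<times> 'a word) set \<Rightarrow> 'a word set monoid" where
  "presented_group R =
    \<lparr>carrier = range (word_class R),
     monoid.mult = (\<lambda>A B. \<Union>u\<in>A. \<Union>v\<in>B. word_class R (u @ v)),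
     one = word_class R []\<rparr>"

lemma word_class_eq_iff: "word_class R u = word_class R v \<longleftrightarrow> word_equiv R u v"
  by (auto simp: word_class_def intro: word_equiv.refl word_equiv.sym word_equiv.trans)

lemma presented_group_mult:
  "word_class R u \<otimes>\<^bsub>presented_group R\<^esub> word_class R v = word_class R (u @ v)"
  by (auto simp: presented_group_def word_class_def
      intro: word_equiv.refl word_equiv.trans word_equiv.append)

lemma word_equiv_inverse: "word_equiv R (map (\<lambda>(a, b). (a, \<not> b)) (rev u) @ u) []"
proof (induction u)
  case Nil
  show ?case by (simp add: word_equiv.refl)
next
  case (Cons x u)
  obtain a b where x: "x = (a, b)" by (cases x)
  let ?v = "map (\<lambda>(a, b). (a, \<not> b)) (rev u)"
  have "word_equiv R [(a, \<not> b), (a, b)] []"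
    using word_equiv.cancel[of R a "\<not> b"] by simp
  then have "word_equiv R (?v @ ([(a, \<not> b), (a, b)] @ u)) (?v @ ([] @ u))"
    by (intro word_equiv.append word_equiv.refl)
  with Cons.IH show ?case
    by (auto simp: x intro: word_equiv.trans)
qed

lemma group_presented_group: "group (presented_group R)"
proof (rule groupI)
  have c: "carrier (presented_group R) = range (word_class R)"
    and o: "\<one>\<^bsub>presented_group R\<^esub> = word_class R []"
    by (simp_all add: presented_group_def)
  show "\<And>x y. x \<in> carrier (presented_group R) \<Longrightarrow> y \<in> carrier (presented_group R) \<Longrightarrow>
      x \<otimes>\<^bsub>presented_group R\<^esub> y \<in> carrier (presented_group R)"
    by (auto simp: c presented_group_mult)
  show "\<one>\<^bsub>presented_group R\<^esub> \<in> carrier (presented_group R)"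
    by (simp add: presented_group_def)
  show "\<And>x y z. x \<in> carrier (presented_group R) \<Longrightarrow> y \<in> carrier (presented_group R) \<Longrightarrow>
      z \<in> carrier (presented_group R) \<Longrightarrow>
      x \<otimes>\<^bsub>presented_group R\<^esub> y \<otimes>\<^bsub>presented_group R\<^esub> z =
      x \<otimes>\<^bsub>presented_group R\<^esub> (y \<otimes>\<^bsub>presented_group R\<^esub> z)"
    by (auto simp: c presented_group_mult)
  show "\<And>x. x \<in> carrier (presented_group R) \<Longrightarrow>
      \<one>\<^bsub>presented_group R\<^esub> \<otimes>\<^bsub>presented_group R\<^esub> x = x"
    by (auto simp: c o presented_group_mult)
  show "\<exists>y\<in>carrier (presented_group R). y \<otimes>\<^bsub>presented_group R\<^esub> x = \<one>\<^bsub>presented_group R\<^esub>"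
    if x: "x \<in> carrier (presented_group R)" for x
  proof -
    obtain u where u: "x = word_class R u" using x by (auto simp: c)
    show ?thesis
      by (rule bexI[of _ "word_class R (map (\<lambda>(a, b). (a, \<not> b)) (rev u))"])
        (auto simp: c o u presented_group_mult word_class_eq_iff word_equiv_inverse)
  qed
qed

section \<open>Thompson's group\<close>

definition thompson_relations :: "(nat word \<times> nat word) set" where
  "thompson_relations =
    {([(i, False), (j, True), (i, True)], [(j + 1, True)]) | i j. i < j}"

definition thompson_F :: "nat word set monoid" where
  "thompson_F = presented_group thompson_relations"

lemma group_thompson_F: "group thompson_F"
  unfolding thompson_F_def by (rule group_presented_group)

definition F_power_times_Z_power ::
    "nat \<Rightarrow> nat \<Rightarrow> ((nat \<Rightarrow> nat word set) \<times> (nat \<Rightarrow> int)) monoid" where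
  "F_power_times_Z_power m n =
    product_group {..<m} (\<lambda>_. thompson_F) \<times>\<times> product_group {..<n} (\<lambda>_. integer_group)"

section \<open>Word metrics and quasi-isometric embeddings\<close>

definition finite_generating_set :: "('a, 'b) monoid_scheme \<Rightarrow> 'a set \<Rightarrow> bool" where
  "finite_generating_set G S \<longleftrightarrow>
    finite S \<and> S \<subseteq> carrier G \<and> generate G S = carrier G"

definition finitely_generated_group :: "('a, 'b) monoid_scheme \<Rightarrow> bool" where
  "finitely_generated_group G \<longleftrightarrow> (\<exists>S. finite_generating_set G S)"

definition word_length :: "('a, 'b) monoid_scheme \<Rightarrow> 'a set \<Rightarrow> 'a \<Rightarrow> nat" where
  "word_length G S g =
    (LEAST k. \<exists>ws. length ws = k \<and> set ws \<subseteq> S \<union> m_inv G ` S \<and>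
      g = foldr (monoid.mult G) ws \<one>\<^bsub>G\<^esub>)"

definition word_metric :: "('a, 'b) monoid_scheme \<Rightarrow> 'a set \<Rightarrow> 'a \<Rightarrow> 'a \<Rightarrow> real" where
  "word_metric G S g h = real (word_length G S (inv\<^bsub>G\<^esub> g \<otimes>\<^bsub>G\<^esub> h))"

definition quasi_isometric_embedding ::
    "'a set \<Rightarrow> ('a \<Rightarrow> 'a \<Rightarrow> real) \<Rightarrow> 'b set \<Rightarrow> ('b \<Rightarrow> 'b \<Rightarrow> real) \<Rightarrow> ('a \<Rightarrow> 'b) \<Rightarrow> bool" where
  "quasi_isometric_embedding X dX Y dY f \<longleftrightarrow>
    f \<in> X \<rightarrow> Y \<and>
    (\<exists>K C :: real. K \<ge> 1 \<and> C \<ge> 0 \<and>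
      (\<forall>x\<in>X. \<forall>y\<in>X. 1 / K * dX x y - C \<le> dY (f x) (f y) \<and>
        dY (f x) (f y) \<le> K * dX x y + C))"

text \<open>The condition does not depend on the choice of the finite generating sets; we ask for it
  for all of them, and for at least one to exist on either side.\<close>

definition qi_embedded_subgroup :: "('a, 'b) monoid_scheme \<Rightarrow> 'a set \<Rightarrow> bool" where
  "qi_embedded_subgroup G H \<longleftrightarrow>
    subgroup H G \<and>
    finitely_generated_group G \<and> finitely_generated_group (G\<lparr>carrier := H\<rparr>) \<and>
    (\<forall>S T. finite_generating_set G S \<and> finite_generating_set (G\<lparr>carrier := H\<rparr>) T \<longrightarrow>
      quasi_isometric_embedding H (word_metric (G\<lparr>carrier := H\<rparr>) T)
        (carrier G) (word_metric G S) (\<lambda>x. x))"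

end

theory Submission
  imports Defs
begin

text \<open>
  If \<open>f : A \<rightarrow> G\<close> is a homomorphism into a finitely generated group and \<open>r : G \<rightarrow> A\<close> is any map with
  \<open>r \<circ> f = id\<close> for which \<open>{r(a)\<inverse> r(a g) | a}\<close> is finite for every \<open>g\<close>, then \<open>r\<close> is Lipschitz for the
  word metrics, so \<open>A\<close> is finitely generated and \<open>f\<close> is a quasi-isometric embedding. Such Lipschitz
  retracts are closed under composition and direct products. Exponent sums give \<open>\<int>\<close> as a retract of
  \<open>F\<close>, so everything reduces to \<open>F \<times> F\<close> being a Lipschitz retract of \<open>F\<close>.

  Think of \<open>F\<close> as acting from the right on the half line, with \<open>x\<^sub>i\<close> splitting the interval \<open>[i, i + 1]\<close>
  into two unit intervals. The two factors are the subgroups supported on \<open>[0, 1]\<close> and \<open>[1, \<infinity>)\<close>. An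
  element that moves the point \<open>1\<close> to \<open>p\<close> maps \<open>[0, 1]\<close> to \<open>[0, p]\<close> and \<open>[1, \<infinity>)\<close> to \<open>[p, \<infinity>)\<close>. The
  dyadic intervals that make up \<open>[0, p]\<close> can be combined by a binary tree branching to the right,
  those in \<open>[p, \<infinity>)\<close> up to the next integer by one branching to the left; this identifies the pieces
  with the half line again and turns the element into a pair of elements of \<open>F\<close>. Each generator
  only changes the trees close to their roots, so it contributes one of finitely many factors,
  uniformly in \<open>p\<close>.

  Repeated shifting \<open>x\<^sub>n \<mapsto> x\<^bsub>n+1\<^esub>\<close> moves a copy of \<open>A\<close> off itself and so yields infinitely many
  subgroups.
\<close>

section \<open>Words\<close>

abbreviation thompson_equiv :: "nat word \<Rightarrow> nat word \<Rightarrow> bool" (infix "\<simeq>" 50) where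
  "u \<simeq> v \<equiv> word_equiv thompson_relations u v"

abbreviation gen :: "nat \<Rightarrow> nat \<times> bool" where
  "gen i \<equiv> (i, True)"

definition word_inv :: "'a word \<Rightarrow> 'a word" where
  "word_inv u = map (\<lambda>(a, b). (a, \<not> b)) (rev u)"

lemma word_inv_simps [simp]:
  "word_inv [] = []" "word_inv [(a, b)] = [(a, \<not> b)]" "word_inv (u @ v) = word_inv v @ word_inv u"
  by (auto simp: word_inv_def)

lemma word_inv_Cons: "word_inv (x # u) = word_inv u @ word_inv [x]"
  by (simp add: word_inv_def)

lemma word_inv_inv [simp]: "word_inv (word_inv u) = u"
  by (induction u) (auto simp: word_inv_Cons[of _ u] word_inv_def rev_map)

lemmas word_equiv_trans [trans] = word_equiv.trans

lemma word_equiv_refl [simp, intro]: "word_equiv R u u"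
  by (rule word_equiv.refl)

lemma word_equiv_append: "word_equiv R u u' \<Longrightarrow> word_equiv R v v' \<Longrightarrow> word_equiv R (u @ v) (u' @ v')"
  by (rule word_equiv.append)

lemma word_equiv_left [simp]: "word_equiv R (word_inv u @ u) []"
  using word_equiv_inverse[of R u] by (simp add: word_inv_def)

lemma word_equiv_right [simp]: "word_equiv R (u @ word_inv u) []"
  using word_equiv_left[of R "word_inv u"] by simp

lemma word_equiv_subst: "word_equiv R u v \<Longrightarrow> word_equiv R (a @ u @ b) (a @ v @ b)"
  by (intro word_equiv_append word_equiv_refl)

lemma word_equiv_insert_right: "word_equiv R (a @ u @ word_inv u @ b) (a @ b)"
  using word_equiv_subst[of R "u @ word_inv u" "[]" a b] by simp

lemma word_equiv_insert_left: "word_equiv R (a @ word_inv u @ u @ b) (a @ b)"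
  using word_equiv_subst[of R "word_inv u @ u" "[]" a b] by simp

lemma word_equiv_cancel_left: "word_equiv R (c @ u) (c @ v) \<longleftrightarrow> word_equiv R u v"
proof
  assume *: "word_equiv R (c @ u) (c @ v)"
  have "word_equiv R u (word_inv c @ c @ u)"
    using word_equiv_insert_left[of R "[]" c u] by (auto intro: word_equiv.sym)
  also have "word_equiv R \<dots> (word_inv c @ c @ v)"
    using word_equiv_append[OF word_equiv_refl *] .
  also have "word_equiv R \<dots> v"
    using word_equiv_insert_left[of R "[]" c v] by auto
  finally show "word_equiv R u v" .
qed (auto intro: word_equiv_append)

lemma word_equiv_cancel_right: "word_equiv R (u @ c) (v @ c) \<longleftrightarrow> word_equiv R u v"
proof
  assume *: "word_equiv R (u @ c) (v @ c)"
  have "word_equiv R u ((u @ c) @ word_inv c)"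
    using word_equiv_insert_right[of R u c "[]"] by (auto intro: word_equiv.sym)
  also have "word_equiv R \<dots> ((v @ c) @ word_inv c)"
    using word_equiv_append[OF * word_equiv_refl] .
  also have "word_equiv R \<dots> v"
    using word_equiv_insert_right[of R v c "[]"] by auto
  finally show "word_equiv R u v" .
qed (auto intro: word_equiv_append)

lemma word_equiv_move_right:
  assumes "word_equiv R (a @ c) (b @ d)" shows "word_equiv R (word_inv b @ a) (d @ word_inv c)"
proof -
  have "word_equiv R (word_inv b @ a) (word_inv b @ (a @ c) @ word_inv c)"
    using word_equiv_insert_right[of R "word_inv b @ a" c "[]"] by (auto intro: word_equiv.sym)
  also have "word_equiv R \<dots> (word_inv b @ (b @ d) @ word_inv c)"
    using word_equiv_subst[OF assms] .
  also have "word_equiv R \<dots> (d @ word_inv c)"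
    using word_equiv_insert_left[of R "[]" b "d @ word_inv c"] by simp
  finally show ?thesis .
qed

lemma word_equiv_inv:
  assumes "word_equiv R u v" shows "word_equiv R (word_inv u) (word_inv v)"
  using word_equiv_move_right[of R "[]" v u "[]"] assms by (simp add: word_equiv.sym)

text \<open>The relations without inverses, the form in which the transducer and substitution
  conditions below are stated.\<close>

lemma thompson_swap:
  assumes "i < j" shows "[gen j, gen i] \<simeq> [gen i, gen (j + 1)]"
proof -
  have "[(i, False), gen j, gen i] \<simeq> [gen (j + 1)]"
    using assms by (intro word_equiv.rel) (auto simp: thompson_relations_def)
  then have "[gen i] @ [(i, False), gen j, gen i] \<simeq> [gen i] @ [gen (j + 1)]"
    by (intro word_equiv_append) auto
  moreover have "[gen i] @ [(i, False), gen j, gen i] \<simeq> [gen j, gen i]"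
    using word_equiv_insert_right[of _ "[]" "[gen i]" "[gen j, gen i]"] by simp
  ultimately show ?thesis
    by (auto intro: word_equiv.trans word_equiv.sym)
qed

section \<open>Transducers\<close>

fun run :: "(nat \<Rightarrow> 'x \<Rightarrow> 'x) \<Rightarrow> (nat \<Rightarrow> 'x \<Rightarrow> 'x) \<Rightarrow> 'x \<Rightarrow> nat word \<Rightarrow> 'x" where
  "run act iact p [] = p"
| "run act iact p ((i, b) # u) = run act iact ((if b then act i else iact i) p) u"

text \<open>An inverse letter must emit the inverse of what \<open>x_i\<close> emits on the way back
  from \<open>iact i p\<close> to \<open>p\<close>; then outputs cancel whenever letters do.\<close>

fun transduce ::
    "(nat \<Rightarrow> 'x \<Rightarrow> 'x) \<Rightarrow> (nat \<Rightarrow> 'x \<Rightarrow> 'x) \<Rightarrow> ('x \<Rightarrow> nat \<Rightarrow> nat word) \<Rightarrow> 'x \<Rightarrow> nat word \<Rightarrow> nat word"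
  where
  "transduce act iact out p [] = []"
| "transduce act iact out p ((i, b) # u) =
    (if b then out p i @ transduce act iact out (act i p) u
     else word_inv (out (iact i p) i) @ transduce act iact out (iact i p) u)"

lemma run_append [simp]: "run act iact p (u @ v) = run act iact (run act iact p u) v"
  by (induction act iact p u rule: run.induct) auto

lemma transduce_append [simp]:
  "transduce act iact out p (u @ v) =
    transduce act iact out p u @ transduce act iact out (run act iact p u) v"
  by (induction act iact out p u rule: transduce.induct) auto

text \<open>There may be infinitely many states. The Lipschitz estimates rest on a fixed word having
  finitely many outputs over all of them.\<close>

lemma finite_range_transduce:
  assumes "\<And>i. finite (range (\<lambda>p. out p i))"
  shows "finite (range (\<lambda>p. transduce act iact out p u))"
proof (induction u)
  case (Cons x u)
  obtain i b where x: "x = (i, b)" by (cases x)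
  let ?A = "range (\<lambda>p. out p i)" and ?B = "range (\<lambda>p. transduce act iact out p u)"
  have "range (\<lambda>p. transduce act iact out p (x # u)) \<subseteq>
      (\<lambda>(v, w). v @ w) ` ((?A \<union> word_inv ` ?A) \<times> ?B)"
  proof -
    have "transduce act iact out p (x # u) \<in> (\<lambda>(v, w). v @ w) ` ((?A \<union> word_inv ` ?A) \<times> ?B)" for p
      by (cases b) (force simp: x intro: image_eqI[of _ _ "(out p i, _)"] image_eqI[of _ _ "(word_inv (out (iact i p) i), _)"])+
    then show ?thesis by blast
  qed
  moreover have "finite ((\<lambda>(v, w). v @ w) ` ((?A \<union> word_inv ` ?A) \<times> ?B))"
    using assms Cons.IH by auto
  ultimately show ?case
    by (rule finite_subset)
qed auto

text \<open>A transducer describes a right action of Thompson's group on the states, together with a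
  cocycle for this action with values in Thompson's group.\<close>

locale transducer =
  fixes act iact :: "nat \<Rightarrow> 'x \<Rightarrow> 'x" and out :: "'x \<Rightarrow> nat \<Rightarrow> nat word"
  assumes act_iact [simp]: "act i (iact i p) = p"
    and iact_act [simp]: "iact i (act i p) = p"
    and act_swap: "i < j \<Longrightarrow> act i (act j p) = act (j + 1) (act i p)"
    and out_swap: "i < j \<Longrightarrow> out p j @ out (act j p) i \<simeq> out p i @ out (act i p) (j + 1)"
begin

lemma run_transduce_word_equiv:
  assumes "u \<simeq> v"
  shows "run act iact p u = run act iact p v \<and>
    transduce act iact out p u \<simeq> transduce act iact out p v"
  using assms
proof (induction arbitrary: p rule: word_equiv.induct)
  case (sym u v)
  then show ?case by (simp add: word_equiv.sym)
next
  case (trans u v w)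
  then show ?case by (metis word_equiv.trans)
next
  case (append u u' v v')
  then show ?case by (simp add: word_equiv_append)
next
  case (cancel a b)
  show ?case by simp
next
  case (rel u v)
  then obtain i j where u: "u = [(i, False), gen j, gen i]" and v: "v = [gen (j + 1)]" and "i < j"
    by (auto simp: thompson_relations_def)
  \<comment> \<open>The left word first undoes \<open>x_i\<close>; seen from the state
    \<open>q\<close> before \<open>x_i\<close>, both sides are comparable by
    \<open>out_swap\<close>.\<close>
  define q where "q = iact i p"
  have p: "p = act i q"
    by (simp add: q_def)
  have "word_inv (out q i) @ out q j @ out (act j q) i \<simeq>
      word_inv (out q i) @ out q i @ out p (j + 1)"
    unfolding p using out_swap[OF \<open>i < j\<close>] by (auto intro: word_equiv_append)
  also have "\<dots> \<simeq> out p (j + 1)"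
    using word_equiv_insert_left[of _ "[]" "out q i" "out p (j + 1)"] by simp
  finally show ?case
    using act_swap[OF \<open>i < j\<close>, of q] by (simp add: u v p)
qed simp

lemma run_word_inv [simp]: "run act iact (run act iact p u) (word_inv u) = p"
proof -
  have "run act iact p (u @ word_inv u) = run act iact p []"
    using run_transduce_word_equiv[OF word_equiv_right[of _ u]] by simp
  then show ?thesis by simp
qed

lemma transduce_word_inv:
  assumes "run act iact p u = p"
  shows "transduce act iact out p (word_inv u) \<simeq> word_inv (transduce act iact out p u)"
proof -
  have "transduce act iact out p (u @ word_inv u) \<simeq> transduce act iact out p []"
    using run_transduce_word_equiv[OF word_equiv_right[of _ u]] by simp
  then have "transduce act iact out p u @ transduce act iact out p (word_inv u) \<simeq>
      transduce act iact out p u @ word_inv (transduce act iact out p u)"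
    using assms by (auto intro: word_equiv.trans[OF _ word_equiv.sym])
  then show ?thesis
    by (simp add: word_equiv_cancel_left)
qed

end

text \<open>With a single state the cocycle condition is that of an endomorphism, so
  well-definedness is a case of the transducer result.\<close>

definition subst :: "(nat \<Rightarrow> nat word) \<Rightarrow> nat word \<Rightarrow> nat word" where
  "subst s = transduce (\<lambda>_ _. ()) (\<lambda>_ _. ()) (\<lambda>_. s) ()"

lemma subst_simps [simp]:
  "subst s [] = []"
  "subst s ((i, b) # u) = (if b then s i else word_inv (s i)) @ subst s u"
  "subst s (u @ v) = subst s u @ subst s v"
  by (auto simp: subst_def)

lemma transducer_subst:
  assumes "\<And>i j. i < j \<Longrightarrow> s j @ s i \<simeq> s i @ s (j + 1)"
  shows "transducer (\<lambda>_ _. ()) (\<lambda>_ _. ()) (\<lambda>_. s)"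
  using assms by unfold_locales auto

lemma subst_word_equiv:
  assumes "\<And>i j. i < j \<Longrightarrow> s j @ s i \<simeq> s i @ s (j + 1)" and "u \<simeq> v"
  shows "subst s u \<simeq> subst s v"
  using transducer.run_transduce_word_equiv[OF transducer_subst[of s] assms(2)] assms(1)
  by (auto simp: subst_def)

text \<open>On the stabiliser of \<open>p\<close> the cocycle is a homomorphism, hence determined by
  its values on the words \<open>s i\<close>.\<close>

lemma (in transducer) transduce_subst:
  assumes fixed: "\<And>i. run act iact p (s i) = p"
    and out: "\<And>i. transduce act iact out p (s i) \<simeq> t i"
  shows "run act iact p (subst s u) = p \<and> transduce act iact out p (subst s u) \<simeq> subst t u"
proof (induction u)
  case (Cons x u)
  obtain i b where x: "x = (i, b)" by (cases x)
  have "transduce act iact out p (word_inv (s i)) \<simeq> word_inv (t i)"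
    using transduce_word_inv[OF fixed] word_equiv_inv[OF out] by (rule word_equiv.trans)
  moreover have "run act iact p (word_inv (s i)) = p"
    using run_word_inv[of p "s i"] fixed by simp
  ultimately show ?case
    using Cons.IH fixed out by (auto simp: x intro: word_equiv_append)
qed auto

lemma subst_gen: "subst (\<lambda>i. [gen i]) u = u"
  by (induction u) (auto split: if_splits)

lemma subst_Nil: "subst (\<lambda>i. []) u = []"
  by (induction u) auto

section \<open>Two commuting copies of Thompson's group\<close>

definition shift :: "nat word \<Rightarrow> nat word" where
  "shift = subst (\<lambda>i. [gen (i + 1)])"

definition vine :: "nat \<Rightarrow> nat word" where
  "vine n = map gen [0..<n]"

lemma vine_Suc: "vine (Suc n) = vine n @ [gen n]"
  by (simp add: vine_def)

text \<open>\<open>x\<^sub>n\<close> transported to the interval \<open>[0, 1]\<close>, which \<open>vine m\<close> cuts into \<open>m + 1\<close> pieces.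
  Any \<open>m > n\<close> may take the place of \<open>n + 1\<close> here, and for large \<open>m\<close> the
  defining relations are inherited from those of the \<open>x\<^sub>n\<close>.\<close>

definition squeeze_gen :: "nat \<Rightarrow> nat word" where
  "squeeze_gen n = vine (n + 1) @ [gen n] @ word_inv (vine (n + 2))"

definition squeeze :: "nat word \<Rightarrow> nat word" where
  "squeeze = subst squeeze_gen"

lemma shift_word_equiv: "u \<simeq> v \<Longrightarrow> shift u \<simeq> shift v"
  unfolding shift_def using thompson_swap[of "Suc _" "Suc _"]
  by (intro subst_word_equiv) auto

text \<open>For \<open>m = n + 1\<close> this is the definition of \<open>squeeze_gen\<close>. Each
  further step moves the new last letter of the vine to the left past \<open>x_n\<close>, which
  lowers its index by one.\<close>

lemma squeeze_gen_vine:
  assumes "n < m"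
  shows "squeeze_gen n @ vine (m + 1) \<simeq> vine m @ [gen n]"
  using assms
proof (induction m)
  case (Suc m)
  show ?case
  proof (cases "n = m")
    case True
    then show ?thesis
      using word_equiv_insert_left[of thompson_relations "vine (n + 1) @ [gen n]" "vine (n + 2)" "[]"]
      by (simp add: squeeze_gen_def)
  next
    case False
    have "(squeeze_gen n @ vine (m + 1)) @ [gen (m + 1)] \<simeq> (vine m @ [gen n]) @ [gen (m + 1)]"
      using Suc False by (intro word_equiv_append[OF _ word_equiv_refl]) auto
    also have "\<dots> \<simeq> vine m @ [gen m, gen n]"
      using thompson_swap[of n m] False Suc.prems
      by (auto intro!: word_equiv_append intro: word_equiv.sym)
    finally show ?thesis
      by (simp add: vine_Suc)
  qed
qed simp

lemma squeeze_gen_swap: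
  assumes "i < j"
  shows "squeeze_gen j @ squeeze_gen i \<simeq> squeeze_gen i @ squeeze_gen (j + 1)"
proof -
  \<comment> \<open>A vine of length \<open>j + 4\<close> is long enough for both factors to pass.
    The claim then becomes the relation for \<open>x_j\<close> and \<open>x_i\<close> behind a
    common prefix, and the vine is cancelled.\<close>
  have two: "squeeze_gen k @ squeeze_gen l @ vine (j + 4) \<simeq> vine (j + 2) @ [gen k, gen l]"
    if "k < j + 2" "l < j + 3" for k l
  proof -
    have "squeeze_gen k @ squeeze_gen l @ vine (j + 4) \<simeq> squeeze_gen k @ vine (j + 3) @ [gen l]"
      using word_equiv_append[OF word_equiv_refl[of _ "squeeze_gen k"] squeeze_gen_vine[of l "j + 3"]] that
      by (simp add: add_ac)
    also have "\<dots> \<simeq> (vine (j + 2) @ [gen k]) @ [gen l]"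
      using word_equiv_append[OF squeeze_gen_vine[of k "j + 2"] word_equiv_refl[of _ "[gen l]"]] that
      by (auto simp: numeral_eq_Suc)
    finally show ?thesis by simp
  qed
  have "squeeze_gen j @ squeeze_gen i @ vine (j + 4) \<simeq> vine (j + 2) @ [gen j, gen i]"
    using two assms by simp
  also have "\<dots> \<simeq> vine (j + 2) @ [gen i, gen (j + 1)]"
    using thompson_swap[OF assms] by (intro word_equiv_append) auto
  also have "\<dots> \<simeq> squeeze_gen i @ squeeze_gen (j + 1) @ vine (j + 4)"
    using two[of i "j + 1"] assms by (auto intro: word_equiv.sym)
  finally have "(squeeze_gen j @ squeeze_gen i) @ vine (j + 4) \<simeq>
      (squeeze_gen i @ squeeze_gen (j + 1)) @ vine (j + 4)"
    by simp
  then show ?thesis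
    by (simp only: word_equiv_cancel_right)
qed

lemma squeeze_word_equiv: "u \<simeq> v \<Longrightarrow> squeeze u \<simeq> squeeze v"
  unfolding squeeze_def by (intro subst_word_equiv squeeze_gen_swap)

text \<open>\<open>x_{j+1}\<close> acts to the right of \<open>[0, 1]\<close>; cutting
  \<open>[0, 1]\<close> into \<open>m + 1\<close> pieces renumbers the intervals there by
  \<open>m\<close>.\<close>

lemma gen_vine: "[gen (j + 1)] @ vine m \<simeq> vine m @ [gen (j + 1 + m)]"
proof (induction m)
  case (Suc m)
  have "([gen (j + 1)] @ vine m) @ [gen m] \<simeq> (vine m @ [gen (j + 1 + m)]) @ [gen m]"
    using word_equiv_append[OF Suc word_equiv_refl] .
  also have "\<dots> \<simeq> vine m @ [gen m, gen (j + 1 + m + 1)]"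
    using thompson_swap[of m "j + 1 + m"] by (auto intro!: word_equiv_append)
  finally show ?case
    by (simp add: vine_Suc)
qed (simp add: vine_def)

section \<open>Commutation of the two copies\<close>

definition commute :: "nat word \<Rightarrow> nat word \<Rightarrow> bool" where
  "commute u v \<longleftrightarrow> u @ v \<simeq> v @ u"

lemma commute_sym: "commute u v \<Longrightarrow> commute v u"
  by (simp add: commute_def word_equiv.sym)

lemma commute_append: "commute u v \<Longrightarrow> commute u w \<Longrightarrow> commute u (v @ w)"
  unfolding commute_def
  using word_equiv_append[of _ "u @ v" "v @ u" w w] word_equiv_append[of _ v v "u @ w" "w @ u"]
  by (auto intro: word_equiv.trans)

lemma commute_word_inv: "commute u v \<Longrightarrow> commute u (word_inv v)"
  using word_equiv_move_right[of thompson_relations u v v u]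
  by (simp add: commute_def word_equiv.sym)

lemma commute_subst:
  assumes "\<And>i. commute u (s i)" shows "commute u (subst s v)"
proof (induction v)
  case (Cons x v)
  then show ?case
    using assms by (cases x) (auto intro!: commute_append commute_word_inv)
qed (simp add: commute_def)

text \<open>The supports meet only in the point 1. On generators, the index \<open>j + 1\<close>
  rises to \<open>j + n + 2\<close> past the first vine and to \<open>j + n + 3\<close> past
  \<open>x_n\<close>, then falls back to \<open>j + 1\<close> past the inverse vine.\<close>

lemma squeeze_shift_commute: "commute (squeeze u) (shift v)"
proof -
  have "commute [gen (j + 1)] (squeeze_gen n)" for j n
  proof -
    let ?g = "gen (j + n + 3)"
    have "[gen (j + 1)] @ vine (n + 1) @ [gen n] \<simeq> (vine (n + 1) @ [gen (j + n + 2)]) @ [gen n]"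
      using word_equiv_append[OF gen_vine[of j "n + 1"] word_equiv_refl[of _ "[gen n]"]]
      by (simp add: add_ac)
    also have "\<dots> \<simeq> vine (n + 1) @ [gen n, ?g]"
      using thompson_swap[of n "j + n + 2"] by (auto intro!: word_equiv_append simp: numeral_eq_Suc)
    finally have 1: "[gen (j + 1)] @ vine (n + 1) @ [gen n] \<simeq> vine (n + 1) @ [gen n] @ [?g]"
      by simp
    have 2: "[?g] @ word_inv (vine (n + 2)) \<simeq> word_inv (vine (n + 2)) @ [gen (j + 1)]"
      using word_equiv_move_right[OF gen_vine[of j "n + 2"]]
      by (auto simp: add_ac numeral_eq_Suc intro: word_equiv.sym)
    have "([gen (j + 1)] @ vine (n + 1) @ [gen n]) @ word_inv (vine (n + 2)) \<simeq>
        (vine (n + 1) @ [gen n] @ [?g]) @ word_inv (vine (n + 2))"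
      using word_equiv_append[OF 1] by blast
    also have "(vine (n + 1) @ [gen n] @ [?g]) @ word_inv (vine (n + 2)) =
        (vine (n + 1) @ [gen n]) @ ([?g] @ word_inv (vine (n + 2)))"
      by simp
    also have "\<dots> \<simeq> (vine (n + 1) @ [gen n]) @ (word_inv (vine (n + 2)) @ [gen (j + 1)])"
      using word_equiv_append[OF word_equiv_refl 2] .
    finally show ?thesis
      by (simp add: commute_def squeeze_gen_def)
  qed
  then show ?thesis
    unfolding squeeze_def shift_def by (intro commute_subst commute_sym[OF commute_subst])
qed

section \<open>Splitting the half line at a dyadic point\<close>

text \<open>\<open>(k, None)\<close> is the integer \<open>k\<close>, and \<open>(k, Some w)\<close> the midpoint of the dyadic subinterval of
  \<open>[k, k + 1]\<close> with address \<open>w\<close>, where \<open>False\<close> means the left half and \<open>True\<close> the right half.\<close>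

type_synonym dyadic = "nat \<times> bool list option"

text \<open>The action of \<open>x_i\<close> on dyadic points: \<open>[i, i + 1]\<close> is
  stretched to \<open>[i, i + 2]\<close> and everything to its right is translated.\<close>

fun split :: "nat \<Rightarrow> dyadic \<Rightarrow> dyadic" where
  "split i (k, None) = (if k \<le> i then k else k + 1, None)"
| "split i (k, Some w) =
    (if k < i then (k, Some w)
     else if i < k then (k + 1, Some w)
     else case w of [] \<Rightarrow> (i + 1, None) | b # v \<Rightarrow> (if b then i + 1 else i, Some v))"

fun merge :: "nat \<Rightarrow> dyadic \<Rightarrow> dyadic" where
  "merge i (k, None) =
    (if k \<le> i then (k, None) else if k = i + 1 then (i, Some []) else (k - 1, None))"
| "merge i (k, Some w) =
    (if k < i then (k, Some w)
     else if k = i then (i, Some (False # w))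
     else if k = i + 1 then (i, Some (True # w))
     else (k - 1, Some w))"

text \<open>The next two functions give the factors that \<open>x\<^sub>i\<close> contributes on \<open>[0, p]\<close> and on \<open>[p, \<infinity>)\<close>. On
  the left the last of the dyadic intervals plays the role of the tail of the half line, so
  splitting it has no effect. On the right the intervals between \<open>p\<close> and the next integer form the
  first unit interval; if \<open>p\<close> is interior to \<open>[k, k + 1]\<close>, then splitting \<open>[k, k + 1]\<close> cuts this first
  interval only when \<open>p < k + 1/2\<close>.\<close>

fun left_out :: "dyadic \<Rightarrow> nat \<Rightarrow> nat word" where
  "left_out (k, None) i = (if i + 1 < k then [gen i] else [])"
| "left_out (k, Some w) i = (if i < k then [gen i] else [])"

fun right_out :: "dyadic \<Rightarrow> nat \<Rightarrow> nat word" where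
  "right_out (k, None) i = (if k \<le> i then [gen (i - k)] else [])"
| "right_out (k, Some w) i =
    (if k < i then [gen (i - k)]
     else if k = i \<and> w \<noteq> [] \<and> \<not> hd w then [gen 0]
     else [])"

abbreviation base :: dyadic where
  "base \<equiv> (Suc 0, None)"

lemma split_merge: "split i (merge i p) = p"
  by (cases "(i, p)" rule: merge.cases) auto

lemma merge_split: "merge i (split i p) = p"
  by (cases "(i, p)" rule: split.cases) (auto split: list.splits)

lemma split_swap: "i < j \<Longrightarrow> split i (split j p) = split (j + 1) (split i p)"
  by (cases "(i, p)" rule: split.cases) (auto split: list.splits)

lemma left_out_swap:
  "i < j \<Longrightarrow> left_out p j @ left_out (split j p) i \<simeq> left_out p i @ left_out (split i p) (j + 1)"
  using thompson_swap[of i j]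
  by (cases "(i, p)" rule: split.cases) (auto split: list.splits)

lemma right_out_swap:
  "i < j \<Longrightarrow> right_out p j @ right_out (split j p) i \<simeq> right_out p i @ right_out (split i p) (j + 1)"
  using thompson_swap[of "i - fst p" "j - fst p"]
  by (cases "(i, p)" rule: split.cases) (auto split: list.splits simp: Suc_diff_le)

interpretation left: transducer split merge left_out
  by unfold_locales (fact split_merge merge_split split_swap left_out_swap)+

interpretation right: transducer split merge right_out
  by unfold_locales (fact split_merge merge_split split_swap right_out_swap)+

lemma finite_left_out: "finite (range (\<lambda>p. left_out p i))"
proof (rule finite_subset)
  show "range (\<lambda>p. left_out p i) \<subseteq> {[], [gen i]}"
  proof
    fix v assume "v \<in> range (\<lambda>p. left_out p i)"
    then obtain p where "v = left_out p i" by auto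
    then show "v \<in> {[], [gen i]}" by (cases "(p, i)" rule: left_out.cases) auto
  qed
qed auto

lemma finite_right_out: "finite (range (\<lambda>p. right_out p i))"
proof (rule finite_subset)
  show "range (\<lambda>p. right_out p i) \<subseteq> insert [] ((\<lambda>j. [gen j]) ` {..i})"
  proof
    fix v assume "v \<in> range (\<lambda>p. right_out p i)"
    then obtain p where "v = right_out p i" by auto
    then show "v \<in> insert [] ((\<lambda>j. [gen j]) ` {..i})"
      by (cases "(p, i)" rule: right_out.cases) auto
  qed
qed auto

section \<open>Values of the two cocycles on the two copies\<close>

abbreviation left_part :: "dyadic \<Rightarrow> nat word \<Rightarrow> nat word" where
  "left_part \<equiv> transduce split merge left_out"

abbreviation right_part :: "dyadic \<Rightarrow> nat word \<Rightarrow> nat word" where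
  "right_part \<equiv> transduce split merge right_out"

text \<open>The letter \<open>x_i\<close> of the vine meets the state \<open>i + 1\<close>, so it
  cuts the last interval left of the point, which neither cocycle records.\<close>

lemma vine_parts:
  "run split merge base (vine m) = (m + 1, None)"
  "left_part base (vine m) = []"
  "right_part base (vine m) = []"
  by (induction m) (auto simp: vine_Suc, auto simp: vine_def)

lemma squeeze_gen_parts:
  "run split merge base (squeeze_gen n) = base"
  "left_part base (squeeze_gen n) \<simeq> [gen n]"
  "right_part base (squeeze_gen n) \<simeq> []"
proof -
  have r: "run split merge (n + 3, None) (word_inv (vine (n + 2))) = base"
    using left.run_word_inv[of "base" "vine (n + 2)"] by (simp add: vine_parts numeral_eq_Suc)
  show 1: "run split merge base (squeeze_gen n) = base"
    using r by (simp add: squeeze_gen_def vine_parts numeral_eq_Suc)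
  \<comment> \<open>Vines have no output from \<open>base\<close>, so this relation reduces the
    output of \<open>squeeze_gen n\<close> to that of \<open>x_n\<close> in the state
    \<open>n + 2\<close>.\<close>
  have v: "squeeze_gen n @ vine (n + 2) \<simeq> vine (n + 1) @ [gen n]"
    using squeeze_gen_vine[of n "n + 1"] by simp
  show "left_part base (squeeze_gen n) \<simeq> [gen n]"
    using left.run_transduce_word_equiv[OF v, of "base"] 1 by (simp add: vine_parts del: One_nat_def)
  show "right_part base (squeeze_gen n) \<simeq> []"
    using right.run_transduce_word_equiv[OF v, of "base"] 1 by (simp add: vine_parts del: One_nat_def)
qed

lemma run_squeeze: "run split merge base (squeeze u) = base"
  using left.transduce_subst[where s = squeeze_gen and t = "\<lambda>n. [gen n]" and u = u, OF squeeze_gen_parts(1,2)] by (simp add: squeeze_def)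

lemma left_part_squeeze: "left_part base (squeeze u) \<simeq> u"
  using left.transduce_subst[where s = squeeze_gen and t = "\<lambda>n. [gen n]" and u = u, OF squeeze_gen_parts(1,2)] by (simp add: squeeze_def subst_gen)

lemma right_part_squeeze: "right_part base (squeeze u) \<simeq> []"
  using right.transduce_subst[where s = squeeze_gen and t = "\<lambda>_. []" and u = u, OF squeeze_gen_parts(1,3)] by (simp add: squeeze_def subst_Nil)

lemma left_part_shift: "left_part base (shift u) \<simeq> []"
  using left.transduce_subst[where p = base and s = "\<lambda>i. [gen (i + 1)]" and t = "\<lambda>_. []" and u = u]
  by (simp add: shift_def subst_Nil)

lemma right_part_shift: "right_part base (shift u) \<simeq> u"
  using right.transduce_subst[where p = base and s = "\<lambda>i. [gen (i + 1)]" and t = "\<lambda>i. [gen i]" and u = u]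
  by (simp add: shift_def subst_gen)


section \<open>Coarse homomorphisms and word length\<close>

lemma foldr_mult_closed:
  assumes "monoid G" "set ws \<subseteq> carrier G" shows "foldr (monoid.mult G) ws \<one>\<^bsub>G\<^esub> \<in> carrier G"
proof -
  interpret monoid G by fact
  show ?thesis using assms(2) by (induction ws) auto
qed

lemma foldr_mult_start:
  assumes "monoid G" "set us \<subseteq> carrier G" "x \<in> carrier G"
  shows "foldr (monoid.mult G) us x = foldr (monoid.mult G) us \<one>\<^bsub>G\<^esub> \<otimes>\<^bsub>G\<^esub> x"
proof -
  interpret monoid G by fact
  show ?thesis
    using assms(2,3) by (induction us) (auto simp: m_assoc foldr_mult_closed[OF assms(1)])
qed

lemma foldr_mult_append:
  assumes "monoid G" "set us \<subseteq> carrier G" "set vs \<subseteq> carrier G"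
  shows "foldr (monoid.mult G) (us @ vs) \<one>\<^bsub>G\<^esub> =
    foldr (monoid.mult G) us \<one>\<^bsub>G\<^esub> \<otimes>\<^bsub>G\<^esub> foldr (monoid.mult G) vs \<one>\<^bsub>G\<^esub>"
  using foldr_mult_start[OF assms(1,2) foldr_mult_closed[OF assms(1,3)]] by simp

lemma foldr_mult_snoc:
  assumes "monoid G" "set us \<subseteq> carrier G" "x \<in> carrier G"
  shows "foldr (monoid.mult G) (us @ [x]) \<one>\<^bsub>G\<^esub> = foldr (monoid.mult G) us \<one>\<^bsub>G\<^esub> \<otimes>\<^bsub>G\<^esub> x"
  using foldr_mult_append[of G us "[x]"] assms by (simp add: monoid.r_one)

lemma generate_foldr:
  assumes "group G" "S \<subseteq> carrier G" "g \<in> generate G S"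
  shows "\<exists>ws. set ws \<subseteq> S \<union> m_inv G ` S \<and> g = foldr (monoid.mult G) ws \<one>\<^bsub>G\<^esub>"
proof -
  interpret group G by fact
  have sub: "S \<union> m_inv G ` S \<subseteq> carrier G"
    using assms(2) by auto
  from assms(3) show ?thesis
  proof (induction rule: generate.induct)
    case one
    show ?case by (rule exI[of _ "[]"]) simp
  next
    case (incl h)
    then show ?case using assms(2) by (intro exI[of _ "[h]"]) auto
  next
    case (inv h)
    then show ?case using assms(2) by (intro exI[of _ "[inv\<^bsub>G\<^esub> h]"]) auto
  next
    case (eng h1 h2)
    then obtain u v where uv: "set u \<subseteq> S \<union> m_inv G ` S" "h1 = foldr (monoid.mult G) u \<one>\<^bsub>G\<^esub>"
      "set v \<subseteq> S \<union> m_inv G ` S" "h2 = foldr (monoid.mult G) v \<one>\<^bsub>G\<^esub>"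
      by blast
    then have "h1 \<otimes>\<^bsub>G\<^esub> h2 = foldr (monoid.mult G) (u @ v) \<one>\<^bsub>G\<^esub>"
      using foldr_mult_append[OF is_monoid, of u v] sub by (simp only:)
    then show ?case
      using uv by (intro exI[of _ "u @ v"]) (simp only: set_append Un_least)
  qed
qed

lemma word_length_le:
  assumes "set ws \<subseteq> S \<union> m_inv G ` S"
  shows "word_length G S (foldr (monoid.mult G) ws \<one>\<^bsub>G\<^esub>) \<le> length ws"
  unfolding word_length_def by (rule Least_le) (use assms in blast)

lemma word_length_attained:
  assumes "group G" "finite_generating_set G S" "g \<in> carrier G"
  obtains ws where "length ws = word_length G S g" "set ws \<subseteq> S \<union> m_inv G ` S"
    "g = foldr (monoid.mult G) ws \<one>\<^bsub>G\<^esub>"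
proof -
  have "\<exists>k ws. length ws = k \<and> set ws \<subseteq> S \<union> m_inv G ` S \<and> g = foldr (monoid.mult G) ws \<one>\<^bsub>G\<^esub>"
    using generate_foldr[OF assms(1), of S g] assms by (auto simp: finite_generating_set_def)
  from LeastI_ex[OF this] show thesis
    using that unfolding word_length_def by blast
qed

lemma generating_set_inverses:
  assumes "group G" "finite_generating_set G S"
  shows "S \<union> m_inv G ` S \<subseteq> carrier G" "finite (S \<union> m_inv G ` S)"
  using assms by (auto simp: finite_generating_set_def group.inv_closed)

lemma word_length_one [simp]: "word_length G S \<one>\<^bsub>G\<^esub> = 0"
  using word_length_le[of "[]" S G] by simp

lemma word_length_mult:
  assumes "group G" "finite_generating_set G S" "g \<in> carrier G" "h \<in> carrier G"
  shows "word_length G S (g \<otimes>\<^bsub>G\<^esub> h) \<le> word_length G S g + word_length G S h"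
proof -
  obtain u where u: "length u = word_length G S g" "set u \<subseteq> S \<union> m_inv G ` S"
    "g = foldr (monoid.mult G) u \<one>\<^bsub>G\<^esub>"
    using word_length_attained[OF assms(1-3)] .
  obtain v where v: "length v = word_length G S h" "set v \<subseteq> S \<union> m_inv G ` S"
    "h = foldr (monoid.mult G) v \<one>\<^bsub>G\<^esub>"
    using word_length_attained[OF assms(1,2,4)] .
  have "g \<otimes>\<^bsub>G\<^esub> h = foldr (monoid.mult G) (u @ v) \<one>\<^bsub>G\<^esub>"
    unfolding u(3) v(3)
    using foldr_mult_append[OF group.is_monoid[OF assms(1)], of u v] u(2) v(2)
      generating_set_inverses(1)[OF assms(1,2)]
    by (metis order.trans)
  then show ?thesis
    using word_length_le[of "u @ v" S G] u v by simp
qed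

text \<open>The Lipschitz condition for left-invariant word metrics, free of generating sets: right
  multiplication by \<open>g\<close> moves every \<open>a\<close> a bounded distance, and
  \<open>E\<close> is uniform in \<open>a\<close>.\<close>

definition coarse_hom :: "('a, 'c) monoid_scheme \<Rightarrow> ('b, 'd) monoid_scheme \<Rightarrow> ('a \<Rightarrow> 'b) \<Rightarrow> bool" where
  "coarse_hom G H f \<longleftrightarrow> f \<in> carrier G \<rightarrow> carrier H \<and>
    (\<forall>g\<in>carrier G. \<exists>E. finite E \<and> E \<subseteq> carrier H \<and>
      (\<forall>a\<in>carrier G. \<exists>e\<in>E. f (a \<otimes>\<^bsub>G\<^esub> g) = f a \<otimes>\<^bsub>H\<^esub> e))"

lemma coarse_hom_closed: "coarse_hom G H f \<Longrightarrow> a \<in> carrier G \<Longrightarrow> f a \<in> carrier H"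
  by (auto simp: coarse_hom_def)

lemma coarse_homE:
  assumes "coarse_hom G H f" "g \<in> carrier G"
  obtains E where "finite E" "E \<subseteq> carrier H"
    "\<And>a. a \<in> carrier G \<Longrightarrow> \<exists>e\<in>E. f (a \<otimes>\<^bsub>G\<^esub> g) = f a \<otimes>\<^bsub>H\<^esub> e"
  using assms unfolding coarse_hom_def by metis

lemma coarse_hom_hom: "f \<in> hom G H \<Longrightarrow> coarse_hom G H f"
  unfolding coarse_hom_def
proof (intro conjI ballI)
  fix g assume "f \<in> hom G H" "g \<in> carrier G"
  then show "\<exists>E. finite E \<and> E \<subseteq> carrier H \<and>
      (\<forall>a\<in>carrier G. \<exists>e\<in>E. f (a \<otimes>\<^bsub>G\<^esub> g) = f a \<otimes>\<^bsub>H\<^esub> e)"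
    by (intro exI[of _ "{f g}"]) (auto simp: hom_def)
qed (auto simp: hom_def)

lemma coarse_hom_comp:
  assumes f: "coarse_hom G H f" and f': "coarse_hom H K f'"
  shows "coarse_hom G K (f' \<circ> f)"
  unfolding coarse_hom_def
proof (intro conjI ballI)
  show "f' \<circ> f \<in> carrier G \<rightarrow> carrier K"
    using assms by (auto simp: coarse_hom_def)
next
  fix g assume g: "g \<in> carrier G"
  obtain E where E: "finite E" "E \<subseteq> carrier H"
    "\<And>a. a \<in> carrier G \<Longrightarrow> \<exists>e\<in>E. f (a \<otimes>\<^bsub>G\<^esub> g) = f a \<otimes>\<^bsub>H\<^esub> e"
    using coarse_homE[OF f g] by metis
  have "\<forall>e\<in>E. \<exists>D. finite D \<and> D \<subseteq> carrier K \<and>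
      (\<forall>a\<in>carrier H. \<exists>d\<in>D. f' (a \<otimes>\<^bsub>H\<^esub> e) = f' a \<otimes>\<^bsub>K\<^esub> d)"
    using f' E(2) by (auto simp: coarse_hom_def)
  then obtain D where D: "\<And>e. e \<in> E \<Longrightarrow> finite (D e)" "\<And>e. e \<in> E \<Longrightarrow> D e \<subseteq> carrier K"
    "\<And>e a. e \<in> E \<Longrightarrow> a \<in> carrier H \<Longrightarrow> \<exists>d\<in>D e. f' (a \<otimes>\<^bsub>H\<^esub> e) = f' a \<otimes>\<^bsub>K\<^esub> d"
    by metis
  show "\<exists>E. finite E \<and> E \<subseteq> carrier K \<and>
      (\<forall>a\<in>carrier G. \<exists>e\<in>E. (f' \<circ> f) (a \<otimes>\<^bsub>G\<^esub> g) = (f' \<circ> f) a \<otimes>\<^bsub>K\<^esub> e)"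
  proof (intro exI[of _ "\<Union>(D ` E)"] conjI ballI)
    fix a assume a: "a \<in> carrier G"
    obtain e where e: "e \<in> E" "f (a \<otimes>\<^bsub>G\<^esub> g) = f a \<otimes>\<^bsub>H\<^esub> e"
      using E(3)[OF a] by blast
    obtain d where "d \<in> D e" "f' (f a \<otimes>\<^bsub>H\<^esub> e) = f' (f a) \<otimes>\<^bsub>K\<^esub> d"
      using D(3)[OF e(1) coarse_hom_closed[OF f a]] by blast
    then show "\<exists>e\<in>\<Union>(D ` E). (f' \<circ> f) (a \<otimes>\<^bsub>G\<^esub> g) = (f' \<circ> f) a \<otimes>\<^bsub>K\<^esub> e"
      using e by auto
  qed (use D E in auto)
qed

lemma coarse_hom_Pair:
  assumes f: "coarse_hom G H f" and f': "coarse_hom G K f'"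
  shows "coarse_hom G (H \<times>\<times> K) (\<lambda>x. (f x, f' x))"
  unfolding coarse_hom_def
proof (intro conjI ballI)
  show "(\<lambda>x. (f x, f' x)) \<in> carrier G \<rightarrow> carrier (H \<times>\<times> K)"
    using assms by (auto simp: coarse_hom_def)
next
  fix g assume g: "g \<in> carrier G"
  obtain E where E: "finite E" "E \<subseteq> carrier H"
    "\<And>a. a \<in> carrier G \<Longrightarrow> \<exists>e\<in>E. f (a \<otimes>\<^bsub>G\<^esub> g) = f a \<otimes>\<^bsub>H\<^esub> e"
    using coarse_homE[OF f g] by metis
  obtain D where D: "finite D" "D \<subseteq> carrier K"
    "\<And>a. a \<in> carrier G \<Longrightarrow> \<exists>e\<in>D. f' (a \<otimes>\<^bsub>G\<^esub> g) = f' a \<otimes>\<^bsub>K\<^esub> e"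
    using coarse_homE[OF f' g] by metis
  show "\<exists>E. finite E \<and> E \<subseteq> carrier (H \<times>\<times> K) \<and>
      (\<forall>a\<in>carrier G. \<exists>e\<in>E. (f (a \<otimes>\<^bsub>G\<^esub> g), f' (a \<otimes>\<^bsub>G\<^esub> g)) = (f a, f' a) \<otimes>\<^bsub>H \<times>\<times> K\<^esub> e)"
  proof (intro exI[of _ "E \<times> D"] conjI ballI)
    fix a assume a: "a \<in> carrier G"
    show "\<exists>e\<in>E \<times> D. (f (a \<otimes>\<^bsub>G\<^esub> g), f' (a \<otimes>\<^bsub>G\<^esub> g)) = (f a, f' a) \<otimes>\<^bsub>H \<times>\<times> K\<^esub> e"
      using E(3)[OF a] D(3)[OF a] by auto
  qed (use D E in auto)
qed

text \<open>Along the prefixes of a shortest word for \<open>g\<close>, \<open>f\<close> starts at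
  the identity and changes by one element of \<open>E\<close> per letter; \<open>E\<close> collects
  the finite sets belonging to the generators and their inverses.\<close>

lemma coarse_hom_words:
  assumes G: "group G" and H: "group H" and S: "finite_generating_set G S"
    and f: "coarse_hom G H f" and one: "f \<one>\<^bsub>G\<^esub> = \<one>\<^bsub>H\<^esub>"
  obtains E where "finite E" "E \<subseteq> carrier H"
    "\<And>g. g \<in> carrier G \<Longrightarrow> \<exists>es. set es \<subseteq> E \<and> length es = word_length G S g \<and>
      f g = foldr (monoid.mult H) es \<one>\<^bsub>H\<^esub>"
proof -
  interpret G: group G by fact
  interpret H: group H by fact
  let ?S = "S \<union> m_inv G ` S"
  note sub = generating_set_inverses[OF G S]
  have "\<forall>s\<in>?S. \<exists>D. finite D \<and> D \<subseteq> carrier H \<and>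
      (\<forall>a\<in>carrier G. \<exists>d\<in>D. f (a \<otimes>\<^bsub>G\<^esub> s) = f a \<otimes>\<^bsub>H\<^esub> d)"
    using f sub(1) unfolding coarse_hom_def by blast
  then obtain D where D: "\<And>s. s \<in> ?S \<Longrightarrow> finite (D s)" "\<And>s. s \<in> ?S \<Longrightarrow> D s \<subseteq> carrier H"
    "\<And>s a. s \<in> ?S \<Longrightarrow> a \<in> carrier G \<Longrightarrow> \<exists>d\<in>D s. f (a \<otimes>\<^bsub>G\<^esub> s) = f a \<otimes>\<^bsub>H\<^esub> d"
    by metis
  let ?E = "\<Union>(D ` ?S)"
  have E: "?E \<subseteq> carrier H"
    using D by blast
  have words: "\<exists>es. set es \<subseteq> ?E \<and> length es = length ws \<and>
      f (foldr (monoid.mult G) ws \<one>\<^bsub>G\<^esub>) = foldr (monoid.mult H) es \<one>\<^bsub>H\<^esub>"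
    if "set ws \<subseteq> ?S" for ws
    using that
  proof (induction ws rule: rev_induct)
    case Nil
    show ?case using one by simp
  next
    case (snoc s ws)
    let ?g = "foldr (monoid.mult G) ws \<one>\<^bsub>G\<^esub>"
    obtain es where es: "set es \<subseteq> ?E" "length es = length ws" "f ?g = foldr (monoid.mult H) es \<one>\<^bsub>H\<^esub>"
      using snoc by auto
    have g: "?g \<in> carrier G"
      using snoc.prems sub(1) by (intro foldr_mult_closed) auto
    obtain d where d: "d \<in> D s" "f (?g \<otimes>\<^bsub>G\<^esub> s) = f ?g \<otimes>\<^bsub>H\<^esub> d"
      using D(3)[OF _ g] snoc.prems by auto
    have "foldr (monoid.mult G) (ws @ [s]) \<one>\<^bsub>G\<^esub> = ?g \<otimes>\<^bsub>G\<^esub> s"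
      using snoc.prems sub(1) by (intro foldr_mult_snoc G.is_monoid) auto
    moreover have "d \<in> ?E"
      using d(1) snoc.prems by auto
    moreover from this have "foldr (monoid.mult H) (es @ [d]) \<one>\<^bsub>H\<^esub> = f ?g \<otimes>\<^bsub>H\<^esub> d"
      using foldr_mult_snoc[OF H.is_monoid, of es d] es E by (metis order.trans subsetD)
    ultimately show ?case
      using es d by (intro exI[of _ "es @ [d]"]) auto
  qed
  show thesis
  proof (rule that[of ?E])
    show "finite ?E" using D(1) sub(2) by blast
    fix g assume "g \<in> carrier G"
    then obtain ws where "length ws = word_length G S g" "set ws \<subseteq> ?S"
      "g = foldr (monoid.mult G) ws \<one>\<^bsub>G\<^esub>"
      using word_length_attained[OF G S] by blast
    then show "\<exists>es. set es \<subseteq> ?E \<and> length es = word_length G S g \<and>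
        f g = foldr (monoid.mult H) es \<one>\<^bsub>H\<^esub>"
      using words[of ws] by metis
  qed (use E in auto)
qed

lemma coarse_hom_word_length:
  assumes G: "group G" and H: "group H" and S: "finite_generating_set G S"
    and T: "finite_generating_set H T"
    and f: "coarse_hom G H f" and one: "f \<one>\<^bsub>G\<^esub> = \<one>\<^bsub>H\<^esub>"
  obtains K where "\<And>g. g \<in> carrier G \<Longrightarrow> word_length H T (f g) \<le> K * word_length G S g"
proof -
  obtain E where E: "finite E" "E \<subseteq> carrier H"
    "\<And>g. g \<in> carrier G \<Longrightarrow> \<exists>es. set es \<subseteq> E \<and> length es = word_length G S g \<and>
      f g = foldr (monoid.mult H) es \<one>\<^bsub>H\<^esub>"
    using coarse_hom_words[OF G H S f one] by metis
  \<comment> \<open>The sum bounds each single length and makes sense for empty \<open>E\<close>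
    too.\<close>
  define K where "K = (\<Sum>e\<in>E. word_length H T e)"
  have K: "word_length H T (foldr (monoid.mult H) es \<one>\<^bsub>H\<^esub>) \<le> K * length es" if "set es \<subseteq> E" for es
    using that
  proof (induction es)
    case (Cons e es)
    have "word_length H T e \<le> K"
      unfolding K_def using Cons.prems E(1) by (intro member_le_sum) auto
    moreover have "foldr (monoid.mult H) es \<one>\<^bsub>H\<^esub> \<in> carrier H"
      using Cons.prems E(2) H by (intro foldr_mult_closed group.is_monoid) auto
    ultimately show ?case
      using word_length_mult[OF H T, of e "foldr (monoid.mult H) es \<one>\<^bsub>H\<^esub>"] Cons E(2) by auto
  qed simp
  show thesis
    using that[of K] E(3) K by metis
qed

text \<open>Every element is a value of \<open>f\<close>, hence a product of the finitely many
  increments \<open>E\<close>.\<close>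

lemma coarse_hom_finitely_generated:
  assumes G: "group G" and H: "group H" and fg: "finitely_generated_group G"
    and f: "coarse_hom G H f" and one: "f \<one>\<^bsub>G\<^esub> = \<one>\<^bsub>H\<^esub>" and onto: "f ` carrier G = carrier H"
  shows "finitely_generated_group H"
proof -
  interpret H: group H by fact
  obtain S where S: "finite_generating_set G S"
    using fg by (auto simp: finitely_generated_group_def)
  obtain E where E: "finite E" "E \<subseteq> carrier H"
    "\<And>g. g \<in> carrier G \<Longrightarrow> \<exists>es. set es \<subseteq> E \<and> length es = word_length G S g \<and>
      f g = foldr (monoid.mult H) es \<one>\<^bsub>H\<^esub>"
    using coarse_hom_words[OF G H S f one] by metis
  have gen: "foldr (monoid.mult H) es \<one>\<^bsub>H\<^esub> \<in> generate H E" if "set es \<subseteq> E" for es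
    using that by (induction es) (auto intro: generate.intros)
  have "carrier H \<subseteq> generate H E"
    using E(3) gen onto by (metis imageE subsetI)
  then have "finite_generating_set H E"
    using E H.generate_incl[of E] by (auto simp: finite_generating_set_def)
  then show ?thesis
    by (auto simp: finitely_generated_group_def)
qed

text \<open>The upper bound on distances comes from the inclusion, a homomorphism; the lower one
  from \<open>r\<close>, which is Lipschitz and fixes \<open>H\<close> pointwise.\<close>

lemma coarse_retraction_qi_embedded:
  assumes G: "group G" and fg: "finitely_generated_group G" and H: "subgroup H G"
    and r: "coarse_hom G (G\<lparr>carrier := H\<rparr>) r" and id: "\<And>h. h \<in> H \<Longrightarrow> r h = h"
  shows "qi_embedded_subgroup G H"
proof -
  interpret G: group G by fact
  interpret H: subgroup H G by fact
  let ?H = "G\<lparr>carrier := H\<rparr>"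
  have gH: "group ?H"
    by (rule H.subgroup_is_group[OF G])
  have one: "r \<one>\<^bsub>G\<^esub> = \<one>\<^bsub>?H\<^esub>"
    using id[OF H.one_closed] by simp
  have "r ` carrier G = carrier ?H"
    using coarse_hom_closed[OF r] id H.subset by (auto simp: image_iff) (metis subsetD)
  then have fgH: "finitely_generated_group ?H"
    using coarse_hom_finitely_generated[OF G gH fg r one] by simp
  have incl: "coarse_hom ?H G (\<lambda>x. x)"
    by (rule coarse_hom_hom) (auto simp: hom_def)
  have "quasi_isometric_embedding H (word_metric ?H T) (carrier G) (word_metric G S) (\<lambda>x. x)"
    if S: "finite_generating_set G S" and T: "finite_generating_set ?H T" for S T
  proof -
    obtain K1 where K1: "\<And>h. h \<in> carrier ?H \<Longrightarrow> word_length G S h \<le> K1 * word_length ?H T h"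
      using coarse_hom_word_length[OF gH G T S incl] by auto
    obtain K2 where K2: "\<And>g. g \<in> carrier G \<Longrightarrow> word_length ?H T (r g) \<le> K2 * word_length G S g"
      using coarse_hom_word_length[OF G gH S T r one] by auto
    \<comment> \<open>One constant for both bounds; the summand 1 ensures
      \<open>K \<ge> 1\<close>.\<close>
    define K where "K = real (K1 + K2 + 1)"
    have "1 / K * word_metric ?H T x y - 0 \<le> word_metric G S x y \<and>
        word_metric G S x y \<le> K * word_metric ?H T x y + 0"
      if xy: "x \<in> H" "y \<in> H" for x y
    proof -
      define h where "h = inv\<^bsub>G\<^esub> x \<otimes>\<^bsub>G\<^esub> y"
      have h: "h \<in> H"
        using xy by (simp add: h_def)
      have m: "word_metric ?H T x y = real (word_length ?H T h)" "word_metric G S x y = real (word_length G S h)"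
        using xy G.m_inv_consistent[OF H] by (simp_all add: word_metric_def h_def)
      have "word_length G S h \<le> K1 * word_length ?H T h"
        using K1 h by simp
      also have "\<dots> \<le> (K1 + K2 + 1) * word_length ?H T h"
        by (intro mult_right_mono) auto
      finally have 1: "real (word_length G S h) \<le> K * real (word_length ?H T h)"
        unfolding K_def of_nat_mult[symmetric] of_nat_le_iff .
      have "word_length ?H T h \<le> K2 * word_length G S h"
        using K2[of h] h id[OF h] by simp
      also have "\<dots> \<le> (K1 + K2 + 1) * word_length G S h"
        by (intro mult_right_mono) auto
      finally have 2: "real (word_length ?H T h) \<le> K * real (word_length G S h)"
        unfolding K_def of_nat_mult[symmetric] of_nat_le_iff .
      have "K > 0"
        by (simp add: K_def)
      with 1 2 show ?thesis
        by (simp add: m field_simps)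
    qed
    moreover have "K \<ge> 1"
      by (simp add: K_def)
    ultimately show ?thesis
      unfolding quasi_isometric_embedding_def using H.subset
      by (intro conjI exI[of _ K] exI[of _ 0]) auto
  qed
  then show ?thesis
    using H fg fgH by (auto simp: qi_embedded_subgroup_def)
qed

section \<open>Lipschitz retracts\<close>

definition lipschitz_retraction ::
    "('a, 'c) monoid_scheme \<Rightarrow> ('b, 'd) monoid_scheme \<Rightarrow> ('a \<Rightarrow> 'b) \<Rightarrow> ('b \<Rightarrow> 'a) \<Rightarrow> bool" where
  "lipschitz_retraction A G f r \<longleftrightarrow>
    f \<in> hom A G \<and> coarse_hom G A r \<and> (\<forall>a\<in>carrier A. r (f a) = a)"

abbreviation lipschitz_retract :: "('a, 'c) monoid_scheme \<Rightarrow> ('b, 'd) monoid_scheme \<Rightarrow> bool" where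
  "lipschitz_retract A G \<equiv> \<exists>f r. lipschitz_retraction A G f r"

lemma lipschitz_retractionD:
  assumes "lipschitz_retraction A G f r" "a \<in> carrier A"
  shows "f a \<in> carrier G" "r (f a) = a"
  using assms by (auto simp: lipschitz_retraction_def hom_in_carrier)

lemma lipschitz_retraction_comp:
  assumes "lipschitz_retraction A B f r" "lipschitz_retraction B G f' r'"
  shows "lipschitz_retraction A G (f' \<circ> f) (r \<circ> r')"
  using assms coarse_hom_comp[of G B r' A r] hom_compose[of f A B f' G]
  by (auto simp: lipschitz_retraction_def hom_in_carrier)

lemma lipschitz_retract_trans:
  "lipschitz_retract A B \<Longrightarrow> lipschitz_retract B G \<Longrightarrow> lipschitz_retract A G"
  by (meson lipschitz_retraction_comp)

lemma lipschitz_retract_DirProd: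
  assumes "lipschitz_retract A A'" "lipschitz_retract B B'"
  shows "lipschitz_retract (A \<times>\<times> B) (A' \<times>\<times> B')"
proof -
  obtain f r g s where *: "lipschitz_retraction A A' f r" "lipschitz_retraction B B' g s"
    using assms by blast
  have "fst \<in> hom (A' \<times>\<times> B') A'" "snd \<in> hom (A' \<times>\<times> B') B'"
    by (auto simp: hom_def)
  then have "coarse_hom (A' \<times>\<times> B') (A \<times>\<times> B) (\<lambda>x. ((r \<circ> fst) x, (s \<circ> snd) x))"
    using * by (intro coarse_hom_Pair coarse_hom_comp[OF coarse_hom_hom])
      (auto simp: lipschitz_retraction_def)
  then have "lipschitz_retraction (A \<times>\<times> B) (A' \<times>\<times> B') (\<lambda>(a, b). (f a, g b))
      (\<lambda>x. ((r \<circ> fst) x, (s \<circ> snd) x))"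
    using * by (auto simp: lipschitz_retraction_def hom_def)
  then show ?thesis by blast
qed

lemma lipschitz_retraction_qi_embedded:
  assumes A: "group A" and G: "group G" and fg: "finitely_generated_group G"
    and fr: "lipschitz_retraction A G f r"
  shows "qi_embedded_subgroup G (f ` carrier A)" "G\<lparr>carrier := f ` carrier A\<rparr> \<cong> A"
proof -
  have f: "f \<in> hom A G" and r: "coarse_hom G A r" and rf: "\<And>a. a \<in> carrier A \<Longrightarrow> r (f a) = a"
    using fr by (auto simp: lipschitz_retraction_def)
  interpret group_hom A G f
    using A G f by (simp add: group_hom_def group_hom_axioms_def)
  let ?H = "G\<lparr>carrier := f ` carrier A\<rparr>"
  have fH: "f \<in> hom A ?H"
    using f by (auto simp: hom_def)
  have "coarse_hom G ?H (f \<circ> r)"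
    using coarse_hom_comp[OF r coarse_hom_hom[OF fH]] .
  then show "qi_embedded_subgroup G (f ` carrier A)"
    using rf by (intro coarse_retraction_qi_embedded[where r = "f \<circ> r", OF G fg img_is_subgroup]) auto
  have "f \<in> iso A ?H"
    using fH rf by (auto simp: iso_def bij_betw_def intro: inj_on_inverseI[of _ r])
  then have "A \<cong> ?H"
    by (auto simp: is_iso_def)
  then show "?H \<cong> A"
    using A by (rule group.iso_sym[rotated])
qed

text \<open>One coordinate at a time: the power with exponent \<open>n + 1\<close> is
  \<open>A\<close> times the power with exponent \<open>n\<close>, a retract of
  \<open>G \<times>\<times> G\<close> and so of \<open>G\<close>.\<close>

lemma lipschitz_retract_product_group:
  assumes G: "group G" and A: "lipschitz_retract A G" and sq: "lipschitz_retract (G \<times>\<times> G) G"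
  shows "lipschitz_retract (product_group {..<n::nat} (\<lambda>_. A)) G"
proof (induction n)
  case 0
  interpret group G by fact
  \<comment> \<open>The empty product has one element, the function that is \<open>undefined\<close>
    everywhere.\<close>
  have "lipschitz_retraction (product_group {..<0::nat} (\<lambda>_. A)) G (\<lambda>_. \<one>\<^bsub>G\<^esub>) (\<lambda>_ _. undefined)"
    unfolding lipschitz_retraction_def
    by (auto intro!: coarse_hom_hom simp: hom_def product_group_def PiE_def extensional_def restrict_def)
  then show ?case by blast
next
  case (Suc n)
  let ?P = "\<lambda>n. product_group {..<n::nat} (\<lambda>_. A)"
  have "lipschitz_retraction (?P (Suc n)) (A \<times>\<times> ?P n)
      (\<lambda>f. (f n, restrict f {..<n})) (\<lambda>(a, f). f(n := a))"
    unfolding lipschitz_retraction_def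
  proof (intro conjI ballI coarse_hom_hom)
    show "(\<lambda>f. (f n, restrict f {..<n})) \<in> hom (?P (Suc n)) (A \<times>\<times> ?P n)"
      by (auto simp: hom_def product_group_def fun_eq_iff PiE_def Pi_def extensional_def)
    show "(\<lambda>(a, f). f(n := a)) \<in> hom (A \<times>\<times> ?P n) (?P (Suc n))"
      by (auto simp: hom_def product_group_def fun_eq_iff PiE_def Pi_def extensional_def less_Suc_eq)
    show "\<And>f. f \<in> carrier (?P (Suc n)) \<Longrightarrow>
        (case (f n, restrict f {..<n}) of (a, f) \<Rightarrow> f(n := a)) = f"
      by (auto simp: product_group_def fun_eq_iff PiE_def extensional_def)
  qed
  then have "lipschitz_retract (?P (Suc n)) (A \<times>\<times> ?P n)"
    by blast
  then show ?case
    using lipschitz_retract_DirProd[OF A Suc] sq by (meson lipschitz_retract_trans)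
qed

section \<open>Lipschitz retracts of Thompson's group\<close>

abbreviation thompson_class :: "nat word \<Rightarrow> nat word set" where
  "thompson_class \<equiv> word_class thompson_relations"

lemma carrier_thompson_F: "carrier thompson_F = range thompson_class"
  by (simp add: thompson_F_def presented_group_def)

lemma one_thompson_F: "\<one>\<^bsub>thompson_F\<^esub> = thompson_class []"
  by (simp add: thompson_F_def presented_group_def)

lemma mult_thompson_F:
  "thompson_class u \<otimes>\<^bsub>thompson_F\<^esub> thompson_class v = thompson_class (u @ v)"
  by (simp add: thompson_F_def presented_group_mult)

definition lift :: "(nat word \<Rightarrow> 'a) \<Rightarrow> nat word set \<Rightarrow> 'a" where
  "lift f X = f (SOME u. thompson_class u = X)"

lemma lift_thompson_class:
  assumes "\<And>u v. u \<simeq> v \<Longrightarrow> f u = f v"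
  shows "lift f (thompson_class u) = f u"
  unfolding lift_def
  by (rule assms) (metis (mono_tags) someI word_class_eq_iff)

definition thompson_map :: "(nat word \<Rightarrow> nat word) \<Rightarrow> nat word set \<Rightarrow> nat word set" where
  "thompson_map f = lift (\<lambda>u. thompson_class (f u))"

lemma thompson_map:
  assumes "\<And>u v. u \<simeq> v \<Longrightarrow> f u \<simeq> f v"
  shows "thompson_map f (thompson_class u) = thompson_class (f u)"
  unfolding thompson_map_def using assms by (intro lift_thompson_class) (simp add: word_class_eq_iff)

text \<open>The output on \<open>u @ v\<close> is that on \<open>u\<close> followed by that on
  \<open>v\<close> from the state reached after \<open>u\<close>. This state varies with
  \<open>u\<close>, but the second factor takes only finitely many values.\<close>

lemma (in transducer) coarse_hom_transduce:
  assumes "\<And>i. finite (range (\<lambda>p. out p i))"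
  shows "coarse_hom thompson_F thompson_F (thompson_map (transduce act iact out p))"
  unfolding coarse_hom_def
proof (intro conjI ballI)
  have map: "thompson_map (transduce act iact out p) (thompson_class u) =
      thompson_class (transduce act iact out p u)" for u
    by (rule thompson_map) (simp add: run_transduce_word_equiv)
  then show "thompson_map (transduce act iact out p) \<in> carrier thompson_F \<rightarrow> carrier thompson_F"
    by (auto simp: carrier_thompson_F)
  fix g assume "g \<in> carrier thompson_F"
  then obtain v where v: "g = thompson_class v"
    by (auto simp: carrier_thompson_F)
  let ?E = "thompson_class ` range (\<lambda>q. transduce act iact out q v)"
  show "\<exists>E. finite E \<and> E \<subseteq> carrier thompson_F \<and> (\<forall>a\<in>carrier thompson_F. \<exists>e\<in>E.
      thompson_map (transduce act iact out p) (a \<otimes>\<^bsub>thompson_F\<^esub> g) =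
      thompson_map (transduce act iact out p) a \<otimes>\<^bsub>thompson_F\<^esub> e)"
  proof (intro exI[of _ ?E] conjI)
    show "finite ?E"
      using assms by (intro finite_imageI[of "range _"] finite_range_transduce)
  qed (auto simp: carrier_thompson_F v mult_thompson_F map)
qed

section \<open>The two copies as Lipschitz retracts\<close>

abbreviation "shift_F \<equiv> thompson_map shift"
abbreviation "squeeze_F \<equiv> thompson_map squeeze"
abbreviation "left_F \<equiv> thompson_map (left_part base)"
abbreviation "right_F \<equiv> thompson_map (right_part base)"

lemma thompson_maps:
  "shift_F (thompson_class u) = thompson_class (shift u)"
  "squeeze_F (thompson_class u) = thompson_class (squeeze u)"
  "left_F (thompson_class u) = thompson_class (left_part base u)"
  "right_F (thompson_class u) = thompson_class (right_part base u)"
  by (simp_all add: thompson_map shift_word_equiv squeeze_word_equiv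
      left.run_transduce_word_equiv right.run_transduce_word_equiv)

lemma shift_append: "shift (u @ v) = shift u @ shift v"
  and squeeze_append: "squeeze (u @ v) = squeeze u @ squeeze v"
  by (simp_all add: shift_def squeeze_def)

lemma shift_retraction: "lipschitz_retraction thompson_F thompson_F shift_F right_F"
  unfolding lipschitz_retraction_def
  by (auto simp: carrier_thompson_F hom_def mult_thompson_F thompson_maps shift_append
      word_class_eq_iff right_part_shift intro!: right.coarse_hom_transduce finite_right_out)

lemma squeeze_retraction: "lipschitz_retraction thompson_F thompson_F squeeze_F left_F"
  unfolding lipschitz_retraction_def
  by (auto simp: carrier_thompson_F hom_def mult_thompson_F thompson_maps squeeze_append
      word_class_eq_iff left_part_squeeze intro!: left.coarse_hom_transduce finite_left_out)

text \<open>Shifted elements are trivial on \<open>[0, 1]\<close>. This later tells the members of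
  the infinite family apart.\<close>

lemma left_shift: "g \<in> carrier thompson_F \<Longrightarrow> left_F (shift_F g) = \<one>\<^bsub>thompson_F\<^esub>"
  using left_part_shift
  by (auto simp only: carrier_thompson_F one_thompson_F thompson_maps word_class_eq_iff[symmetric])

lemma lipschitz_retract_square: "lipschitz_retract (thompson_F \<times>\<times> thompson_F) thompson_F"
proof -
  let ?f = "\<lambda>(g, h). squeeze_F g \<otimes>\<^bsub>thompson_F\<^esub> shift_F h"
  \<comment> \<open>Commuting \<open>squeeze u'\<close> with \<open>shift v\<close> makes
    \<open>?f\<close> multiplicative.\<close>
  have "squeeze (u @ u') @ shift (v @ v') \<simeq> (squeeze u @ shift v) @ squeeze u' @ shift v'" for u u' v v'
    using word_equiv_subst[of _ "squeeze u' @ shift v" "shift v @ squeeze u'" "squeeze u" "shift v'"]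
      squeeze_shift_commute[of u' v]
    by (simp add: commute_def squeeze_append shift_append)
  then have "?f \<in> hom (thompson_F \<times>\<times> thompson_F) thompson_F"
    by (auto simp: hom_def carrier_thompson_F mult_thompson_F thompson_maps word_class_eq_iff)
  moreover have "coarse_hom thompson_F (thompson_F \<times>\<times> thompson_F) (\<lambda>g. (left_F g, right_F g))"
    using shift_retraction squeeze_retraction
    by (intro coarse_hom_Pair) (auto simp: lipschitz_retraction_def)
  \<comment> \<open>\<open>squeeze u\<close> returns to the state \<open>base\<close>, so
    \<open>shift v\<close> is read from there and each cocycle sees just one of the two
    factors.\<close>
  moreover have "left_part base (squeeze u @ shift v) \<simeq> u"
    "right_part base (squeeze u @ shift v) \<simeq> v" for u v
    using word_equiv_append[OF left_part_squeeze[of u] left_part_shift[of v]]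
      word_equiv_append[OF right_part_squeeze[of u] right_part_shift[of v]]
    by (simp_all add: run_squeeze)
  ultimately have "lipschitz_retraction (thompson_F \<times>\<times> thompson_F) thompson_F ?f (\<lambda>g. (left_F g, right_F g))"
    by (auto simp: lipschitz_retraction_def carrier_thompson_F mult_thompson_F thompson_maps word_class_eq_iff)
  then show ?thesis by blast
qed

section \<open>The integers as a retract\<close>

definition exponent :: "nat word \<Rightarrow> int" where
  "exponent u = (\<Sum>(i, b)\<leftarrow>u. if i = 0 then (if b then 1 else - 1) else 0)"

text \<open>In a relation \<open>j\<close> and \<open>j + 1\<close> are positive, so
  \<open>x_0\<close> can occur only as the conjugating letter, where it cancels.\<close>

lemma exponent_word_equiv: "u \<simeq> v \<Longrightarrow> exponent u = exponent v"
  by (induction rule: word_equiv.induct) (auto simp: exponent_def thompson_relations_def)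

lemma lift_exponent: "lift exponent (thompson_class u) = exponent u"
  by (rule lift_thompson_class) (rule exponent_word_equiv)

text \<open>The powers of \<open>x_0\<close> split the exponent homomorphism, so here the retraction
  is itself a homomorphism.\<close>

lemma lipschitz_retract_integer_group: "lipschitz_retract integer_group thompson_F"
proof -
  interpret group thompson_F by (rule group_thompson_F)
  let ?x = "thompson_class [gen 0]"
  have x: "?x \<in> carrier thompson_F"
    by (simp add: carrier_thompson_F)
  have e: "lift exponent \<in> hom thompson_F integer_group"
    by (auto simp: hom_def carrier_thompson_F mult_thompson_F lift_exponent exponent_def)
  interpret e: group_hom thompson_F integer_group "lift exponent"
    using e by (simp add: group_hom_def group_hom_axioms_def group_thompson_F)
  have "lift exponent (?x [^]\<^bsub>thompson_F\<^esub> k) = k" for k :: int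
    using e.hom_int_pow[OF x, of k] by (simp add: lift_exponent exponent_def)
  then have "lipschitz_retraction integer_group thompson_F (\<lambda>k. ?x [^]\<^bsub>thompson_F\<^esub> k) (lift exponent)"
    using x by (auto simp: lipschitz_retraction_def hom_def int_pow_mult intro!: coarse_hom_hom e)
  then show ?thesis by blast
qed

lemma lipschitz_retract_F_power_times_Z_power:
  "lipschitz_retract (F_power_times_Z_power m n) thompson_F"
proof -
  have "lipschitz_retraction thompson_F thompson_F (\<lambda>x. x) (\<lambda>x. x)"
    by (auto simp: lipschitz_retraction_def hom_def intro!: coarse_hom_hom)
  then have "lipschitz_retract thompson_F thompson_F"
    by blast
  then show ?thesis
    unfolding F_power_times_Z_power_def
    by (intro lipschitz_retract_trans[OF lipschitz_retract_DirProd lipschitz_retract_square]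
        lipschitz_retract_product_group[OF group_thompson_F _ lipschitz_retract_square]
        lipschitz_retract_integer_group)
qed

lemma group_F_power_times_Z_power: "group (F_power_times_Z_power m n)"
  unfolding F_power_times_Z_power_def
  by (intro DirProd_group product_group group_thompson_F group_integer_group)

lemma F_power_times_Z_power_nontrivial:
  assumes "(m, n) \<noteq> (0, 0)"
  obtains a where "a \<in> carrier (F_power_times_Z_power m n)" "a \<noteq> \<one>\<^bsub>F_power_times_Z_power m n\<^esub>"
proof -
  let ?x = "thompson_class [gen 0]"
  \<comment> \<open>A constant tuple, nontrivial as soon as there is a coordinate; in
    \<open>F\<close> the exponent detects \<open>x_0\<close>.\<close>
  let ?a = "(\<lambda>i\<in>{..<m}. ?x, \<lambda>i\<in>{..<n}. 1)"
  have "?x \<noteq> \<one>\<^bsub>thompson_F\<^esub>"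
    using exponent_word_equiv[of "[gen 0]" "[]"]
    by (auto simp: one_thompson_F word_class_eq_iff exponent_def)
  then have "?a \<noteq> \<one>\<^bsub>F_power_times_Z_power m n\<^esub>"
    using assms by (auto simp: F_power_times_Z_power_def fun_eq_iff)
  moreover have "?a \<in> carrier (F_power_times_Z_power m n)"
    by (auto simp: F_power_times_Z_power_def carrier_thompson_F)
  ultimately show thesis
    using that by blast
qed

text \<open>For \<open>i \<ge> 1\<close>, conjugation by \<open>x_0\<close> turns \<open>x_i\<close>
  into \<open>x_{i+1}\<close>.\<close>

lemma finitely_generated_thompson_F: "finitely_generated_group thompson_F"
proof -
  interpret group thompson_F by (rule group_thompson_F)
  let ?S = "{thompson_class [gen 0], thompson_class [gen 1]}"
  let ?G = "generate thompson_F ?S"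
  have S: "?S \<subseteq> carrier thompson_F"
    by (auto simp: carrier_thompson_F)
  interpret S: subgroup ?G thompson_F
    by (rule generate_is_subgroup[OF S])
  have inv: "inv\<^bsub>thompson_F\<^esub> (thompson_class [(i, b)]) = thompson_class [(i, \<not> b)]" for i b
    by (rule inv_equality)
      (use word_equiv.cancel[of thompson_relations i "\<not> b"] in
        \<open>auto simp: mult_thompson_F one_thompson_F word_class_eq_iff carrier_thompson_F\<close>)
  have pos: "thompson_class [gen i] \<in> ?G" for i
  proof (induction i)
    case 0
    show ?case by (auto intro: generate.incl)
  next
    case (Suc i)
    show ?case
    proof (cases "i = 0")
      case True
      then show ?thesis by (auto intro: generate.incl)
    next
      case False
      have "thompson_class [(0, False), gen i, gen 0] = thompson_class [gen (i + 1)]"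
        using False by (auto simp: word_class_eq_iff thompson_relations_def intro!: word_equiv.rel)
      moreover have "thompson_class [gen 0] \<in> ?G"
        by (auto intro: generate.incl)
      then have "inv\<^bsub>thompson_F\<^esub> (thompson_class [gen 0]) \<otimes>\<^bsub>thompson_F\<^esub>
          (thompson_class [gen i] \<otimes>\<^bsub>thompson_F\<^esub> thompson_class [gen 0]) \<in> ?G"
        using Suc by blast
      ultimately show ?thesis
        by (simp add: inv mult_thompson_F)
    qed
  qed
  have letter: "thompson_class [(i, b)] \<in> ?G" for i b
    using pos[of i] S.m_inv_closed[OF pos[of i]] by (cases b) (simp_all add: inv)
  have "thompson_class u \<in> ?G" for u
  proof (induction u)
    case Nil
    show ?case using S.one_closed by (simp add: one_thompson_F)
  next
    case (Cons x u)
    then show ?case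
      using S.m_closed[OF letter Cons.IH, of "fst x" "snd x"] by (simp add: mult_thompson_F)
  qed
  then have "finite_generating_set thompson_F ?S"
    using S S.subset by (auto simp: finite_generating_set_def carrier_thompson_F)
  then show ?thesis
    by (auto simp: finitely_generated_group_def)
qed

section \<open>Infinitely many copies\<close>

lemma shift_power_retraction:
  "lipschitz_retraction thompson_F thompson_F (shift_F ^^ i) (right_F ^^ i)"
proof (induction i)
  case 0
  show ?case
    by (auto simp: lipschitz_retraction_def hom_def intro!: coarse_hom_hom)
next
  case (Suc i)
  show ?case
    \<comment> \<open>Retractions compose in the order opposite to embeddings, so the two powers are
      unfolded at different ends.\<close>
    unfolding funpow.simps(2)[of i shift_F] funpow_Suc_right[of i right_F]
    using lipschitz_retraction_comp[OF Suc shift_retraction] .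
qed

text \<open>A group has only one trivial subgroup, whence the condition on
  \<open>inj H\<close>.\<close>

theorem theorem3p4:
  fixes m n :: nat
  shows "\<exists>H :: nat \<Rightarrow> nat word set set.
    (\<forall>i. qi_embedded_subgroup thompson_F (H i) \<and>
      thompson_F\<lparr>carrier := H i\<rparr> \<cong> F_power_times_Z_power m n) \<and>
    ((m, n) \<noteq> (0, 0) \<longrightarrow> inj H)"
proof -
  let ?A = "F_power_times_Z_power m n"
  interpret A: group ?A by (rule group_F_power_times_Z_power)
  obtain f r where fr: "lipschitz_retraction ?A thompson_F f r"
    using lipschitz_retract_F_power_times_Z_power by blast
  interpret f: group_hom ?A thompson_F f
    using fr group_thompson_F
    by (simp add: lipschitz_retraction_def group_hom_def group_hom_axioms_def A.group_axioms)
  \<comment> \<open>\<open>squeeze_F\<close> puts the copy on \<open>[0, 1]\<close> and the shifts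
    move it to \<open>[i, i + 1]\<close>.\<close>
  define g where "g i = (shift_F ^^ i) \<circ> (squeeze_F \<circ> f)" for i
  define H where "H i = g i ` carrier ?A" for i
  have ret: "lipschitz_retraction ?A thompson_F (g i) ((r \<circ> left_F) \<circ> (right_F ^^ i))" for i
    unfolding g_def
    by (intro lipschitz_retraction_comp[OF _ shift_power_retraction]
        lipschitz_retraction_comp[OF fr squeeze_retraction])
  have "H i \<noteq> H j" if "i < j" and mn: "(m, n) \<noteq> (0, 0)" for i j
  proof
    assume eq: "H i = H j"
    obtain a where a: "a \<in> carrier ?A" "a \<noteq> \<one>\<^bsub>?A\<^esub>"
      using F_power_times_Z_power_nontrivial[OF mn] .
    obtain b where b: "b \<in> carrier ?A" "g i a = g j b"
      using eq a unfolding H_def by blast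
    \<comment> \<open>\<open>g j b\<close> is shifted \<open>j\<close> times, and \<open>x\<close>
      is what remains after removing \<open>i + 1\<close> of these shifts.\<close>
    define x where "x = (shift_F ^^ (j - i - 1)) (squeeze_F (f b))"
    have x: "x \<in> carrier thompson_F"
      unfolding x_def
      by (rule lipschitz_retractionD(1)[OF shift_power_retraction
            lipschitz_retractionD(1)[OF squeeze_retraction lipschitz_retractionD(1)[OF fr b(1)]]])
    have "j = i + Suc (j - i - 1)"
      using \<open>i < j\<close> by simp
    then have "shift_F ^^ j = (shift_F ^^ i) \<circ> (shift_F \<circ> (shift_F ^^ (j - i - 1)))"
      using funpow_add[of i "Suc (j - i - 1)" shift_F] by (simp only: funpow.simps)
    then have "g j b = (shift_F ^^ i) (shift_F x)"
      by (simp only: g_def x_def comp_apply)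
    then have *: "(right_F ^^ i) (g j b) = shift_F x"
      using lipschitz_retractionD(2)[OF shift_power_retraction lipschitz_retractionD(1)[OF shift_retraction x]]
      by simp
    \<comment> \<open>The retraction of \<open>g i\<close> recovers \<open>a\<close>. But
      \<open>g j b\<close> with \<open>i\<close> shifts undone is still a shift, which
      \<open>left_F\<close> kills, so \<open>a\<close> would be trivial.\<close>
    have "a = r (left_F ((right_F ^^ i) (g j b)))"
      using lipschitz_retractionD(2)[OF ret[of i] a(1)] by (simp only: b(2) comp_apply)
    also have "\<dots> = r (f \<one>\<^bsub>?A\<^esub>)"
      by (simp only: * left_shift[OF x] f.hom_one)
    also have "\<dots> = \<one>\<^bsub>?A\<^esub>"
      by (rule lipschitz_retractionD(2)[OF fr A.one_closed])
    finally show False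
      using a by simp
  qed
  then have "(m, n) \<noteq> (0, 0) \<longrightarrow> inj H"
    by (metis injI nat_neq_iff)
  moreover have "qi_embedded_subgroup thompson_F (H i) \<and> thompson_F\<lparr>carrier := H i\<rparr> \<cong> ?A" for i
    using lipschitz_retraction_qi_embedded[OF A.group_axioms group_thompson_F finitely_generated_thompson_F ret]
    by (simp add: H_def)
  ultimately show ?thesis
    by blast
qed

end
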